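(* Let $F$ be a field of characteristic $0$. Denote by $I$ the irreducible left $M_2(F)$-module isomorphic to the minimal left ideal $\langle e_{12}, e_{22}\rangle_F \subset M_2(F)$ ($e_{ij}$ are the matrix units). Let $A = M_2(F)\oplus I$ (direct sum of left ideals), where $M_2(F)$ acts on $I$ from the left by the module structure, $I\,M_2(F) := 0$ and $I^2:=0$. Let $T_3=\lbrace e_1,e_2\rbrace$ be the right zero band of two elements, and let $A$ be $T_3$-graded by $A^{(e_1)}=(M_2(F),0)$, $A^{(e_2)}=\lbrace (\varphi(a), a) \mid a \in I \rbrace$, where $\varphi \colon I \hookrightarrow M_2(F)$ is the natural embedding (with image $\langle e_{12}, e_{22}\rangle_F$), a homomorphism of left $M_2(F)$-modules. Then the algebra $A$ is $T_3$-graded-simple.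
   Context: A right zero band is a semigroup $T$ with $t_1t_2=t_2$ for all $t_1,t_2\in T$. For a semigroup $T$, an algebra $A$ is $T$-graded if $A=\bigoplus_{t\in T}A^{(t)}$ (direct sum of subspaces) with $A^{(h)}A^{(t)}\subseteq A^{(ht)}$ for all $h,t\in T$. A subspace $V$ of $A$ is graded if $V=\bigoplus_{t\in T}V\cap A^{(t)}$. A $T$-graded algebra $A$ is graded-simple if $A^2\ne 0$ and $A$ has no graded two-sided ideals other than $A$ and $0$. *)

theory Defs
  imports "HOL-Analysis.Analysis"
begin

section \<open>Semigroup-graded algebras\<close>

class right_zero_band = semigroup_mult +
  assumes right_zero: "s * t = t"

text \<open>Associative algebras over a field, not necessarily with a unit element. The algebra is
  the whole type \<open>'a\<close>; its multiplication is an explicit parameter.\<close>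

locale assoc_algebra = vector_space scale
  for scale :: "'f::field \<Rightarrow> 'a::ab_group_add \<Rightarrow> 'a" +
  fixes mul :: "'a \<Rightarrow> 'a \<Rightarrow> 'a"
  assumes mul_assoc: "mul (mul x y) z = mul x (mul y z)"
    and mul_add_left: "mul (x + y) z = mul x z + mul y z"
    and mul_add_right: "mul x (y + z) = mul x y + mul x z"
    and mul_scale_left: "mul (scale c x) y = scale c (mul x y)"
    and mul_scale_right: "mul x (scale c y) = scale c (mul x y)"

text \<open>\<open>V\<close> is the internal direct sum of the family of subspaces \<open>B\<close>; the index type may be
  infinite, in which case sums have finite support.\<close>

definition (in vector_space) is_direct_sum :: "'b set \<Rightarrow> ('t \<Rightarrow> 'b set) \<Rightarrow> bool" where
  "is_direct_sum V B \<longleftrightarrow>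
     (\<forall>t. subspace (B t)) \<and>
     V = span (\<Union>t. B t) \<and>
     (\<forall>S f. finite S \<longrightarrow> (\<forall>t\<in>S. f t \<in> B t) \<longrightarrow> (\<Sum>t\<in>S. f t) = 0 \<longrightarrow> (\<forall>t\<in>S. f t = 0))"

locale graded_algebra = assoc_algebra scale mul
  for scale :: "'f::field \<Rightarrow> 'a::ab_group_add \<Rightarrow> 'a"
    and mul :: "'a \<Rightarrow> 'a \<Rightarrow> 'a" +
  fixes grade :: "'t::semigroup_mult \<Rightarrow> 'a set"
  assumes direct_sum_grade: "is_direct_sum UNIV grade"
    and mul_grade: "x \<in> grade h \<Longrightarrow> y \<in> grade t \<Longrightarrow> mul x y \<in> grade (h * t)"
begin

definition graded_subspace :: "'a set \<Rightarrow> bool" where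
  "graded_subspace V \<longleftrightarrow> subspace V \<and> is_direct_sum V (\<lambda>t. V \<inter> grade t)"

definition graded_ideal :: "'a set \<Rightarrow> bool" where
  "graded_ideal V \<longleftrightarrow>
     graded_subspace V \<and> (\<forall>a. \<forall>v\<in>V. mul a v \<in> V \<and> mul v a \<in> V)"

end

locale graded_simple_algebra = graded_algebra scale mul grade
  for scale :: "'f::field \<Rightarrow> 'a::ab_group_add \<Rightarrow> 'a"
    and mul :: "'a \<Rightarrow> 'a \<Rightarrow> 'a"
    and grade :: "'t::semigroup_mult \<Rightarrow> 'a set" +
  assumes square_nonzero: "span {mul x y | x y. True} \<noteq> {0}"
    and graded_ideals: "graded_ideal V \<Longrightarrow> V = {0} \<or> V = UNIV"


section \<open>Left modules over a matrix ring\<close>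

text \<open>The product of the matrix ring is \<open>(**)\<close>; the type class product \<open>(*)\<close> on this type is
  componentwise. The field acts on a module through the scalar matrices \<open>mat c\<close>.\<close>

definition mat_scale :: "'f::field \<Rightarrow> 'f^'n^'n \<Rightarrow> 'f^'n^'n" where
  "mat_scale c m = (\<chi> i j. c * m $ i $ j)"

locale matrix_module =
  fixes act :: "'f::field^'n^'n \<Rightarrow> 'i::ab_group_add \<Rightarrow> 'i"
  assumes act_add_left: "act (m + n) x = act m x + act n x"
    and act_add_right: "act m (x + y) = act m x + act m y"
    and act_mul: "act (m ** n) x = act m (act n x)"
    and act_one: "act (mat 1) x = x"
begin

definition submodule :: "'i set \<Rightarrow> bool" where
  "submodule N \<longleftrightarrow>
     0 \<in> N \<and> (\<forall>x\<in>N. \<forall>y\<in>N. x + y \<in> N) \<and> (\<forall>m. \<forall>x\<in>N. act m x \<in> N)"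

end

locale irreducible_matrix_module = matrix_module act
  for act :: "'f::field^'n^'n \<Rightarrow> 'i::ab_group_add \<Rightarrow> 'i" +
  assumes nonzero: "(UNIV :: 'i set) \<noteq> {0}"
    and submodules: "submodule N \<Longrightarrow> N = {0} \<or> N = UNIV"

definition matrix_unit :: "'n \<Rightarrow> 'n \<Rightarrow> 'f::field^'n^'n" where
  "matrix_unit i j = axis i (axis j 1)"

text \<open>The span of \<open>e\<^sub>1\<^sub>2\<close> and \<open>e\<^sub>2\<^sub>2\<close>. The elements of the index type \<open>2\<close> are \<open>1\<close> and \<open>2\<close>
  (with \<open>2 = 0\<close>).\<close>

definition second_column_ideal :: "('f::field^2^2) set" where
  "second_column_ideal = module.span mat_scale {matrix_unit 1 2, matrix_unit 2 2}"

lemma vector_space_mat_scale: "vector_space (mat_scale :: 'f::field \<Rightarrow> 'f^'n^'n \<Rightarrow> 'f^'n^'n)"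
  by standard (simp_all add: mat_scale_def vec_eq_iff algebra_simps)

lemma second_column_ideal_eq:
  "(second_column_ideal :: ('f::field^2^2) set) = {m. m $ 1 $ 1 = 0 \<and> m $ 2 $ 1 = 0}"
proof -
  interpret vector_space "mat_scale :: 'f \<Rightarrow> 'f^2^2 \<Rightarrow> 'f^2^2"
    by (rule vector_space_mat_scale)
  have comb: "mat_scale (c :: 'f) (matrix_unit 1 2) + mat_scale d (matrix_unit 2 2)
      = (m :: 'f^2^2) \<longleftrightarrow> m $ 1 $ 1 = 0 \<and> m $ 2 $ 1 = 0 \<and> m $ 1 $ 2 = c \<and> m $ 2 $ 2 = d" for c d m
    by (auto simp: mat_scale_def matrix_unit_def axis_def vec_eq_iff forall_2)
  have "m \<in> span {matrix_unit 1 2, matrix_unit 2 2} \<longleftrightarrow>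
      (\<exists>c d. mat_scale c (matrix_unit 1 2) + mat_scale d (matrix_unit 2 2) = m)" for m :: "'f^2^2"
    by (simp add: span_insert span_singleton) (metis add.commute diff_add_cancel add_diff_cancel_left')
  then show ?thesis
    unfolding second_column_ideal_def comb by auto
qed

definition module_embedding ::
  "('f::field^'n^'n \<Rightarrow> 'i::ab_group_add \<Rightarrow> 'i) \<Rightarrow> ('i \<Rightarrow> 'f^'n^'n) \<Rightarrow> bool" where
  "module_embedding act \<phi> \<longleftrightarrow>
     inj \<phi> \<and> (\<forall>x y. \<phi> (x + y) = \<phi> x + \<phi> y) \<and> (\<forall>m x. \<phi> (act m x) = m ** \<phi> x)"


text \<open>The column vectors form such a module, so these notions are jointly satisfiable.\<close>

lemma irreducible_column_module:
  "irreducible_matrix_module ((*v) :: 'f::field^2^2 \<Rightarrow> 'f^2 \<Rightarrow> 'f^2)"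
proof
  show "(UNIV :: ('f^2) set) \<noteq> {0}"
    by (metis UNIV_I axis_eq_0_iff singletonD zero_neq_one)
next
  fix N :: "('f^2) set"
  assume "matrix_module.submodule (*v) N"
  moreover have "matrix_module ((*v) :: 'f^2^2 \<Rightarrow> 'f^2 \<Rightarrow> 'f^2)"
    by standard (simp_all add: matrix_vector_mult_add_rdistrib matrix_vector_right_distrib
        matrix_vector_mul_assoc)
  ultimately have N: "0 \<in> N" "\<And>m x. x \<in> N \<Longrightarrow> m *v x \<in> N"
    by (auto simp: matrix_module.submodule_def)
  have "y \<in> N" if "x \<in> N" "x \<noteq> 0" for x y :: "'f^2"
  proof -
    from that obtain k where k: "x $ k \<noteq> 0"
      by (auto simp: vec_eq_iff)
    have "(\<chi> i j. if j = k then y $ i / x $ k else 0) *v x = y"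
      using k by (simp add: matrix_vector_mult_def vec_eq_iff if_distrib[of "\<lambda>z. z * _"] sum.delta cong: if_cong)
    then show ?thesis
      using N(2)[OF that(1)] by metis
  qed
  with N(1) show "N = {0} \<or> N = UNIV"
    by blast
qed (simp_all add: matrix_vector_mult_add_rdistrib matrix_vector_right_distrib
        matrix_vector_mul_assoc)

lemma column_module_embedding:
  defines "\<phi> \<equiv> (\<lambda>x :: 'f::field^2. (\<chi> i j. if j = 2 then x $ i else 0) :: 'f^2^2)"
  shows "module_embedding (*v) \<phi>" "range \<phi> = second_column_ideal"
proof -
  show "module_embedding (*v) \<phi>"
    by (auto simp: module_embedding_def \<phi>_def inj_def vec_eq_iff matrix_vector_mult_def
        matrix_matrix_mult_def forall_2 sum_2)
  have "m \<in> range \<phi>" if "m $ 1 $ 1 = 0" "m $ 2 $ 1 = 0" for m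
    using that by (intro image_eqI[of _ _ "\<chi> i. m $ i $ 2"]) (auto simp: \<phi>_def vec_eq_iff forall_2)
  then show "range \<phi> = second_column_ideal"
    unfolding second_column_ideal_eq by (auto simp: \<phi>_def)
qed


section \<open>The algebra \<open>M\<^sub>2(F) \<oplus> I\<close> and its grading\<close>

datatype T3 = E1 | E2

instantiation T3 :: right_zero_band
begin

definition times_T3 :: "T3 \<Rightarrow> T3 \<Rightarrow> T3" where
  "times_T3 s t = t"

instance by standard (simp_all add: times_T3_def)

end

definition A_scale ::
  "('f::field^2^2 \<Rightarrow> 'i::ab_group_add \<Rightarrow> 'i) \<Rightarrow> 'f \<Rightarrow> (('f^2^2) \<times> 'i) \<Rightarrow> (('f^2^2) \<times> 'i)" where
  "A_scale act c = (\<lambda>(m, a). (mat_scale c m, act (mat c) a))"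

text \<open>In \<open>(m + a)(n + b) = mn + mb + an + ab\<close> the last two terms vanish.\<close>

definition A_mul ::
  "('f::field^2^2 \<Rightarrow> 'i::ab_group_add \<Rightarrow> 'i) \<Rightarrow>
     (('f^2^2) \<times> 'i) \<Rightarrow> (('f^2^2) \<times> 'i) \<Rightarrow> (('f^2^2) \<times> 'i)" where
  "A_mul act = (\<lambda>(m, a) (n, b). (m ** n, act m b))"

fun A_grade :: "('i::ab_group_add \<Rightarrow> 'f::field^2^2) \<Rightarrow> T3 \<Rightarrow> (('f^2^2) \<times> 'i) set" where
  "A_grade \<phi> E1 = {(m, 0) | m. True}"
| "A_grade \<phi> E2 = {(\<phi> a, a) | a. True}"

end

theory Submission
  imports Defs
begin

text \<open>A nonzero graded ideal contains a nonzero homogeneous element. If it is \<open>(\<phi> a, a)\<close>, then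
  right multiplication by \<open>(1, 0)\<close> kills the second component and gives \<open>(\<phi> a, 0)\<close>, which is
  nonzero since \<open>\<phi>\<close> is injective. So the ideal always contains some \<open>(m, 0)\<close> with \<open>m \<noteq> 0\<close>, and
  hence \<open>(1, 0)\<close> by the simplicity of the matrix ring. As \<open>(1, 0)\<close> is a left unit of the algebra,
  the ideal is everything.\<close>

text \<open>Sandwiching between matrix units isolates a single entry of \<open>m\<close> and moves
  it to any chosen position; this drives the simplicity of the matrix ring.\<close>

lemma matrix_unit_mult_matrix_unit:
  fixes m :: "'f::field^'n^'n"
  shows "matrix_unit i k ** m ** matrix_unit l j = mat_scale (m $ k $ l) (matrix_unit i j)"
proof -
  have "(matrix_unit i k ** m) $ p $ q = (if p = i then m $ k $ q else 0)" for p q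
    by (auto simp: matrix_matrix_mult_def matrix_unit_def axis_def if_distrib[of "\<lambda>z. z * _"]
        cong: if_cong)
  then have "(matrix_unit i k ** m ** matrix_unit l j) $ p $ q
      = (if p = i \<and> q = j then m $ k $ l else 0)" for p q
    unfolding matrix_matrix_mult_def[of "matrix_unit i k ** m"]
    by (auto simp: matrix_unit_def axis_def if_distrib[of "\<lambda>z. z $ _"] if_distrib[of "\<lambda>z. _ * z"]
        cong: if_cong)
  then show ?thesis
    by (auto simp: vec_eq_iff mat_scale_def matrix_unit_def axis_def)
qed

lemma sum_matrix_unit: "(\<Sum>i\<in>UNIV. matrix_unit i i) = (mat 1 :: 'f::field^'n^'n)"
  by (auto simp: vec_eq_iff matrix_unit_def axis_def mat_def if_distrib[of "\<lambda>z. z $ _"]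
      cong: if_cong)

text \<open>Scaling becomes a left multiplication, so closure under the ring product already gives
  closure under scalars.\<close>

lemma mat_scale_eq_mult: "mat_scale c m = mat c ** (m :: 'f::field^'n^'n)"
  by (simp add: vec_eq_iff mat_scale_def matrix_matrix_mult_def mat_def
      if_distrib[of "\<lambda>z. z * _"] cong: if_cong)

lemma mult_mat_scale: "m ** mat_scale c n = mat_scale c (m ** (n :: 'f::field^'n^'n))"
  by (simp add: vec_eq_iff mat_scale_def matrix_matrix_mult_def sum_distrib_left mult_ac)

lemma matrix_mult_add_rdistrib: "(A + B) ** C = A ** C + B ** (C :: 'a::semiring_1^'n^'m)"
  by (simp add: vec_eq_iff matrix_matrix_mult_def sum.distrib algebra_simps)

text \<open>A nonzero entry of \<open>m\<close>, isolated by matrix units and rescaled to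
  \<open>1\<close>, yields every diagonal unit, and these sum to the identity.\<close>

lemma mat_1_in_two_sided_ideal:
  fixes W :: "('f::field^'n^'n) set"
  assumes zero: "0 \<in> W" and add: "\<And>x y. x \<in> W \<Longrightarrow> y \<in> W \<Longrightarrow> x + y \<in> W"
    and left: "\<And>a x. x \<in> W \<Longrightarrow> a ** x \<in> W" and right: "\<And>a x. x \<in> W \<Longrightarrow> x ** a \<in> W"
    and m: "m \<in> W" "m \<noteq> 0"
  shows "mat 1 \<in> W"
proof -
  obtain k l where kl: "m $ k $ l \<noteq> 0"
    using m(2) by (auto simp: vec_eq_iff)
  have "matrix_unit i i \<in> W" for i
  proof -
    have "mat_scale (inverse (m $ k $ l)) (matrix_unit i k ** m ** matrix_unit l i) \<in> W"
      unfolding mat_scale_eq_mult by (intro left right m(1))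
    also have "mat_scale (inverse (m $ k $ l)) (matrix_unit i k ** m ** matrix_unit l i)
        = matrix_unit i i"
      using kl by (simp add: matrix_unit_mult_matrix_unit) (simp add: mat_scale_def vec_eq_iff)
    finally show ?thesis .
  qed
  \<comment> \<open>A sum over an infinite set is \<open>0\<close> by convention, so
    \<open>zero\<close> settles that case of the induction.\<close>
  then have "(\<Sum>i\<in>S. matrix_unit i i) \<in> W" for S
    by (induction S rule: infinite_finite_induct) (auto intro: zero add)
  then show ?thesis
    by (metis sum_matrix_unit)
qed

text \<open>If every component were zero, so would be their span. This supplies the nonzero
  homogeneous element of a graded ideal.\<close>

lemma (in vector_space) is_direct_sum_nontrivial:
  assumes "is_direct_sum V B" "V \<noteq> {0}"
  obtains t v where "v \<in> B t" "v \<noteq> 0"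
proof (rule ccontr)
  assume "\<not> thesis"
  with that have "(\<Union>t. B t) \<subseteq> {0}"
    by blast
  then have "span (\<Union>t. B t) \<subseteq> {0}"
    by (meson span_minimal subspace_single_0)
  moreover have "V = span (\<Union>t. B t)"
    using assms(1) by (simp add: is_direct_sum_def)
  ultimately show False
    using assms(2) span_zero by blast
qed

lemma (in matrix_module) act_zero_right: "act m 0 = 0"
  using act_add_right[of m 0 0] by simp

lemma UNIV_T3: "(UNIV :: T3 set) = {E1, E2}"
  by (auto intro: T3.exhaust)

lemma A_assoc_algebra:
  assumes "matrix_module act"
  shows "assoc_algebra (A_scale act) (A_mul act)"
proof -
  interpret matrix_module act by fact
  interpret M: vector_space "mat_scale :: 'a \<Rightarrow> 'a^2^2 \<Rightarrow> 'a^2^2"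
    by (rule vector_space_mat_scale)
  \<comment> \<open>Scalar matrices are central; this lets scalars pass through the right factor in
    the module component.\<close>
  have commute: "act m (act (mat c) a) = act (mat c) (act m a)" for m c a
  proof -
    have "m ** mat c = mat c ** m"
      using mult_mat_scale[of m c "mat 1"] by (simp add: mat_scale_eq_mult)
    then show ?thesis
      by (metis act_mul)
  qed
  have mat_add: "mat (c + d) = mat c + (mat d :: 'a^2^2)" for c d
    by (simp add: vec_eq_iff mat_def)
  have mat_mult: "mat (c * d) = mat c ** (mat d :: 'a^2^2)" for c d
    by (simp flip: mat_scale_eq_mult) (simp add: vec_eq_iff mat_def mat_scale_def)
  show ?thesis
  proof
    show "A_mul act (A_scale act c x) y = A_scale act c (A_mul act x y)" for c x y
      by (cases x; cases y) (simp add: A_mul_def A_scale_def mat_scale_eq_mult matrix_mul_assoc act_mul)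
    show "A_mul act x (A_scale act c y) = A_scale act c (A_mul act x y)" for c x y
      by (cases x; cases y) (simp add: A_mul_def A_scale_def mult_mat_scale commute)
  qed (auto simp: A_scale_def A_mul_def act_add_left act_add_right act_mul act_one
      matrix_mul_assoc matrix_add_ldistrib matrix_mult_add_rdistrib M.scale_left_distrib
      M.scale_right_distrib mat_add mat_mult split: prod.splits)
qed

lemma A_graded_algebra:
  fixes act :: "'f::field^2^2 \<Rightarrow> 'i::ab_group_add \<Rightarrow> 'i"
  assumes "matrix_module act" "module_embedding act \<phi>"
  shows "graded_algebra (A_scale act) (A_mul act) (A_grade \<phi>)"
proof -
  interpret matrix_module act by fact
  interpret assoc_algebra "A_scale act" "A_mul act"
    by (rule A_assoc_algebra) fact
  have add: "\<phi> (x + y) = \<phi> x + \<phi> y" and act: "\<phi> (act m x) = m ** \<phi> x" for m x y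
    using assms(2) by (auto simp: module_embedding_def)
  have zero: "\<phi> 0 = 0"
    using add[of 0 0] by simp
  have subspace: "subspace (A_grade \<phi> t)" for t
    by (cases t) (auto simp: subspace_def A_scale_def zero_prod_def add zero act act_zero_right
        mat_scale_eq_mult)
  have "x \<in> span (\<Union>t. A_grade \<phi> t)" for x
  proof -
    obtain m a where x: "x = (m, a)"
      by fastforce
    \<comment> \<open>The component \<open>a\<close> can only come from degree \<open>E2\<close>,
      which forces this splitting of \<open>(m, a)\<close>.\<close>
    have "(m - \<phi> a, 0) \<in> A_grade \<phi> E1" "(\<phi> a, a) \<in> A_grade \<phi> E2"
      by auto
    then have "(m - \<phi> a, 0) + (\<phi> a, a) \<in> span (\<Union>t. A_grade \<phi> t)"
      by (blast intro: span_add span_base)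
    then show ?thesis
      by (simp add: x)
  qed
  moreover have "f t = 0"
    if f: "\<forall>t\<in>S. f t \<in> A_grade \<phi> t" "(\<Sum>t\<in>S. f t) = 0" and t: "t \<in> S" for S f t
  proof -
    \<comment> \<open>Extending \<open>f\<close> by zero reduces an arbitrary index set
      \<open>S\<close> to the full set of two degrees.\<close>
    define g where "g s = (if s \<in> S then f s else 0)" for s
    have "g s \<in> A_grade \<phi> s" for s
      using f(1) subspace[of s] by (auto simp: g_def subspace_def)
    from this[of E1] this[of E2] obtain m a where ma: "g E1 = (m, 0)" "g E2 = (\<phi> a, a)"
      by auto
    have "finite (UNIV :: T3 set)"
      by (simp add: UNIV_T3)
    then have "(\<Sum>s\<in>UNIV. g s) = (\<Sum>s\<in>S. f s)"
      unfolding g_def by (rule sum.mono_neutral_cong_right) auto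
    then have "g E1 + g E2 = 0"
      using f(2) by (simp add: UNIV_T3)
    \<comment> \<open>The second components give \<open>a = 0\<close>; then
      \<open>\<phi> a = 0\<close>, and the first components give \<open>m = 0\<close>.\<close>
    then have "g E1 = 0 \<and> g E2 = 0"
      using ma by (auto simp: zero_prod_def zero)
    then show ?thesis
      using t by (cases t) (simp_all add: g_def)
  qed
  ultimately have "is_direct_sum UNIV (A_grade \<phi>)"
    unfolding is_direct_sum_def using subspace by blast
  \<comment> \<open>The right factor alone decides the degree. For degree \<open>E2\<close> this is
    the homomorphism property: \<open>m ** \<phi> b = \<phi> (act m b)\<close>.\<close>
  moreover have "A_mul act x y \<in> A_grade \<phi> (h * t)"
    if "x \<in> A_grade \<phi> h" "y \<in> A_grade \<phi> t" for x y h t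
    using that by (cases x; cases t) (auto simp: A_mul_def right_zero act act_zero_right)
  ultimately show ?thesis
    by unfold_locales
qed

theorem proposition6:
  fixes act :: "'f::field_char_0^2^2 \<Rightarrow> 'i::ab_group_add \<Rightarrow> 'i"
    and \<phi> :: "'i \<Rightarrow> 'f^2^2"
  assumes "irreducible_matrix_module act"
    and "module_embedding act \<phi>"
    and "range \<phi> = second_column_ideal"
  shows "graded_simple_algebra (A_scale act) (A_mul act) (A_grade \<phi>)"
proof -
  interpret irreducible_matrix_module act by fact
  interpret graded_algebra "A_scale act" "A_mul act" "A_grade \<phi>"
    using matrix_module_axioms assms(2) by (rule A_graded_algebra)
  have unit: "A_mul act (mat 1, 0) x = x" for x
    by (cases x) (simp add: A_mul_def act_one)
  \<comment> \<open>This instance of additivity simplifies to \<open>\<phi> 0 = 0\<close>, so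
    injectivity means a trivial kernel.\<close>
  have "inj \<phi>" and add: "\<phi> (0 + 0) = \<phi> 0 + \<phi> 0"
    using assms(2) unfolding module_embedding_def by blast+
  then have phi_nonzero: "\<phi> a \<noteq> 0" if "a \<noteq> 0" for a
    using that by (auto dest: injD[of \<phi> a 0])
  have ideals: "V = UNIV" if "graded_ideal V" "V \<noteq> {0}" for V
  proof -
    have V: "subspace V" "is_direct_sum V (\<lambda>t. V \<inter> A_grade \<phi> t)"
      and left: "\<And>a v. v \<in> V \<Longrightarrow> A_mul act a v \<in> V"
      and right: "\<And>a v. v \<in> V \<Longrightarrow> A_mul act v a \<in> V"
      using that(1) by (simp_all add: graded_ideal_def graded_subspace_def del: split_paired_All)
    obtain t v where v: "v \<in> V" "v \<in> A_grade \<phi> t" "v \<noteq> 0"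
      by (rule is_direct_sum_nontrivial[OF V(2) \<open>V \<noteq> {0}\<close>]) auto
    obtain m where m: "(m, 0) \<in> V" "m \<noteq> 0"
    proof (cases t)
      case E1
      with v that show thesis
        by (auto simp: zero_prod_def)
    next
      case E2
      with v obtain a where a: "v = (\<phi> a, a)"
        by auto
      with v(3) have "\<phi> a \<noteq> 0"
        using phi_nonzero add by (auto simp: zero_prod_def)
      moreover have "(\<phi> a, 0) \<in> V"
        using right[OF v(1), of "(mat 1, 0)"] by (simp add: a A_mul_def act_zero_right)
      ultimately show thesis
        using that by blast
    qed
    \<comment> \<open>Since \<open>(a, 0)\<close> and \<open>(x, 0)\<close> multiply to
      \<open>(a ** x, 0)\<close>, this slice of \<open>V\<close> is a two-sided ideal of the matrix
      ring.\<close>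
    have "mat 1 \<in> {m. (m, 0) \<in> V}"
    proof (rule mat_1_in_two_sided_ideal)
      show "0 \<in> {m. (m, 0) \<in> V}"
        using V(1) by (simp add: subspace_def zero_prod_def)
      show "x + y \<in> {m. (m, 0) \<in> V}" if "x \<in> {m. (m, 0) \<in> V}" "y \<in> {m. (m, 0) \<in> V}" for x y
        using subspace_add[OF V(1), of "(x, 0)" "(y, 0)"] that by simp
      show "a ** x \<in> {m. (m, 0) \<in> V}" if "x \<in> {m. (m, 0) \<in> V}" for a x
        using left[of "(x, 0)" "(a, 0)"] that by (simp add: A_mul_def act_zero_right)
      show "x ** a \<in> {m. (m, 0) \<in> V}" if "x \<in> {m. (m, 0) \<in> V}" for a x
        using right[of "(x, 0)" "(a, 0)"] that by (simp add: A_mul_def act_zero_right)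
    qed (use m in auto)
    then show ?thesis
      using right[of "(mat 1, 0)"] by (auto simp: unit)
  qed
  have "(mat 1 :: 'f^2^2) \<noteq> 0"
    by (simp add: vec_eq_iff mat_def)
  \<comment> \<open>The left unit is idempotent, hence a nonzero product.\<close>
  moreover have "(mat 1, 0) \<in> span {A_mul act x y | x y. True}"
    using unit[of "(mat 1, 0)"] by (intro span_base CollectI) metis
  ultimately have "span {A_mul act x y | x y. True} \<noteq> {0}"
    by (auto simp: zero_prod_def)
  with ideals show ?thesis
    by (intro graded_simple_algebra.intro graded_algebra_axioms
        graded_simple_algebra_axioms.intro) blast+
qed

end
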